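(* Let $\alpha,\beta\in\mathbb{N}$ be relatively prime with $\alpha<\beta$. Then $$\bigl(\alpha L(q^{\alpha})-\beta L(q^{\beta})\bigr)^{2}=(\alpha-\beta)^{2}+\sum_{n=1}^{\infty}\Bigl(240\,\alpha^{2}\,\sigma_{3}\bigl(\tfrac{n}{\alpha}\bigr)+240\,\beta^{2}\,\sigma_{3}\bigl(\tfrac{n}{\beta}\bigr)+48\,\alpha(\beta-6n)\,\sigma\bigl(\tfrac{n}{\alpha}\bigr)+48\,\beta(\alpha-6n)\,\sigma\bigl(\tfrac{n}{\beta}\bigr)-1152\,\alpha\beta\,W_{(\alpha,\beta)}(n)\Bigr)q^{n}.$$
   Context: $\mathbb{N}$ is the set of positive integers, $\mathbb{N}_0$ the set of nonnegative integers. For $k\in\mathbb{N}_0$ and $n\in\mathbb{N}$, $\sigma_{k}(n)=\sum_{0<d\mid n}d^{k}$, $\sigma=\sigma_1$, and $\sigma_k(m)=0$ for all $m\notin\mathbb{N}$ (in particular $\sigma_k(0)=0$ and $\sigma_k(n/\alpha)=0$ when $\alpha\nmid n$). For $q\in\mathbb{C}$ with $|q|<1$, $L(q)=1-24\sum_{n=1}^{\infty}\sigma(n)q^{n}$. The convolution sum is $W_{(\alpha,\beta)}(n)=\sum_{(l,m)\in\mathbb{N}_0^2,\ \alpha l+\beta m=n}\sigma(l)\sigma(m)$. *)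

theory Defs
  imports Complex_Main
begin

text \<open>The argument is real because the convention \<open>\<sigma>\<^sub>k(n/\<alpha>) = 0\<close> for \<open>\<alpha>\<close> not dividing \<open>n\<close>
  is part of the definition; \<open>\<sigma>\<^sub>k\<close> also vanishes at \<open>0\<close>.\<close>

definition divisor_sigma :: "nat \<Rightarrow> real \<Rightarrow> nat" where
  "divisor_sigma k x =
     (if x \<in> \<nat> \<and> x > 0 then (\<Sum>d | 0 < d \<and> d dvd nat \<lfloor>x\<rfloor>. d ^ k) else 0)"

text \<open>Meaningful only for \<open>norm q < 1\<close>. The sum over \<open>n \<ge> 1\<close> is written with \<open>Suc n\<close>, \<open>n \<ge> 0\<close>.\<close>

definition eisenstein_L :: "complex \<Rightarrow> complex" where
  "eisenstein_L q = 1 - 24 * (\<Sum>n. of_nat (divisor_sigma 1 (real (Suc n))) * q ^ Suc n)"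

text \<open>For \<open>\<alpha>, \<beta> > 0\<close> the index set is finite.\<close>

definition convolution_W :: "nat \<Rightarrow> nat \<Rightarrow> nat \<Rightarrow> nat" where
  "convolution_W \<alpha> \<beta> n =
     (\<Sum>(l, m) \<in> {(l, m). \<alpha> * l + \<beta> * m = n}. divisor_sigma 1 (real l) * divisor_sigma 1 (real m))"

definition square_coeff :: "nat \<Rightarrow> nat \<Rightarrow> nat \<Rightarrow> complex" where
  "square_coeff \<alpha> \<beta> n =
       240 * of_nat \<alpha> ^ 2 * of_nat (divisor_sigma 3 (real n / real \<alpha>))
     + 240 * of_nat \<beta> ^ 2 * of_nat (divisor_sigma 3 (real n / real \<beta>))
     + 48 * of_nat \<alpha> * (of_nat \<beta> - 6 * of_nat n) * of_nat (divisor_sigma 1 (real n / real \<alpha>))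
     + 48 * of_nat \<beta> * (of_nat \<alpha> - 6 * of_nat n) * of_nat (divisor_sigma 1 (real n / real \<beta>))
     - 1152 * of_nat \<alpha> * of_nat \<beta> * of_nat (convolution_W \<alpha> \<beta> n)"

end

theory Submission
  imports Defs
begin

text \<open>
  Write \<open>F\<^sub>\<alpha>(q) = \<Sum> \<sigma>(n/\<alpha>) q\<^sup>n\<close>, so that \<open>L(q\<^sup>\<alpha>) = 1 - 24 F\<^sub>\<alpha>(q)\<close>. Expanding the square on the
  left-hand side leaves linear terms in \<open>F\<^sub>\<alpha>\<close> and \<open>F\<^sub>\<beta>\<close> and the three products \<open>F\<^sub>\<alpha>\<^sup>2\<close>, \<open>F\<^sub>\<beta>\<^sup>2\<close>
  and \<open>F\<^sub>\<alpha> F\<^sub>\<beta>\<close>. By the Cauchy product the coefficients of \<open>F\<^sub>\<gamma> F\<^sub>\<delta>\<close> are the convolution sums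
  \<open>W\<^sub>(\<^sub>\<gamma>\<^sub>,\<^sub>\<delta>\<^sub>)(n)\<close> (lemma \<open>sigma_series_product_sums\<close>). The mixed sum stays in the answer, whereas the
  sums with equal weights reduce to \<open>W\<^sub>(\<^sub>1\<^sub>,\<^sub>1\<^sub>)\<close>, which has the closed form found by Besge:
  \<open>12 \<Sum> \<sigma>(l) \<sigma>(n - l) = 5 \<sigma>\<^sub>3(n) + (1 - 6n) \<sigma>(n)\<close> (lemma \<open>convolution_W_1_1_closed_form\<close>).
  Everything else is comparison of coefficients.

  Besge's formula, equivalent to Ramanujan's \<open>q L'(q) = (L(q)\<^sup>2 - M(q)) / 12\<close> with
  \<open>M(q) = 1 + 240 \<Sum> \<sigma>\<^sub>3(n) q\<^sup>n\<close>, is proved here in the combinatorial manner of Liouville.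
  The sum is \<open>\<Sum> a b\<close> over the positive quadruples with
  \<open>a x + b y = n\<close>, and \<open>4 a b = (a + b)\<^sup>2 - (a - b)\<^sup>2\<close>. One subtraction step of the Euclidean
  algorithm, \<open>(a, b, x, y) \<mapsto> (a, b - a, x + y, y)\<close>, maps the quadruples with \<open>a < b\<close> bijectively to
  those with \<open>y < x\<close> (lemma \<open>sum_quads_subtract\<close>). Together with the symmetry exchanging \<open>(a, x)\<close>
  and \<open>(b, y)\<close> it makes all sums over the off-diagonal regions cancel. What remains are sums over the
  diagonals \<open>x = y\<close> and \<open>a = b\<close>, and these are divisor sums of \<open>n\<close>.
\<close>

section \<open>Values of the divisor function\<close>

lemma divisor_sigma_of_nat:
  assumes "0 < n"
  shows "divisor_sigma k (real n) = (\<Sum>d | d dvd n. d ^ k)"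
proof -
  have "{d. 0 < d \<and> d dvd n} = {d. d dvd n}"
    using assms by (auto intro: dvd_pos_nat)
  then show ?thesis using assms by (simp add: divisor_sigma_def)
qed

lemma divisor_sigma_0 [simp]: "divisor_sigma k 0 = 0"
  by (simp add: divisor_sigma_def)

lemma divisor_sigma_nonintegral:
  assumes "0 < \<alpha>" and "\<not> \<alpha> dvd n"
  shows "divisor_sigma k (real n / real \<alpha>) = 0"
proof -
  have "real n / real \<alpha> \<notin> \<nat>"
  proof
    assume "real n / real \<alpha> \<in> \<nat>"
    then obtain m where "real n / real \<alpha> = real m" by (elim Nats_cases)
    then have "real n = real (\<alpha> * m)" using assms(1) by (simp add: field_simps)
    then have "n = \<alpha> * m" by (simp only: of_nat_eq_iff)
    with assms(2) show False by simp
  qed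
  then show ?thesis by (simp add: divisor_sigma_def)
qed

text \<open>A crude bound; any polynomial one gives convergence in the unit disc.\<close>

lemma divisor_sigma_1_le_square: "divisor_sigma 1 (real n) \<le> n ^ 2"
proof (cases "n = 0")
  case False
  then have sub: "{d. d dvd n} \<subseteq> {1..n}"
    by (auto dest: dvd_imp_le dvd_pos_nat intro: Suc_leI)
  have "(\<Sum>d | d dvd n. d) \<le> (\<Sum>d\<in>{1..n}. n)"
    using sub by (intro order.trans[OF sum_mono2[of "{1..n}"] sum_mono]) auto
  then show ?thesis using False by (simp add: divisor_sigma_of_nat power2_eq_square)
qed simp

text \<open>Summing over factorisations instead of divisors covers \<open>n = 0\<close> as well: \<open>0\<close> has no factorisation
  into positive numbers.\<close>

lemma divisor_sigma_1_factor_pairs: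
  "divisor_sigma 1 (real n) = (\<Sum>(d, e) \<in> {(d, e). 0 < d \<and> 0 < e \<and> d * e = n}. d)"
proof (cases "n = 0")
  case False
  then show ?thesis
    unfolding divisor_sigma_of_nat[OF False[unfolded neq0_conv]]
    by (intro sum.reindex_bij_witness[of _ fst "\<lambda>d. (d, n div d)"])
       (auto intro: Nat.gr0I)
qed (auto intro!: sum.neutral)

section \<open>The convolution sum with equal weights\<close>

text \<open>The constraint \<open>P\<close> cuts out the regions and diagonals between which the symmetries of the
  equation \<open>a x + b y = n\<close> move sums.\<close>

definition quads :: "nat \<Rightarrow> (nat \<Rightarrow> nat \<Rightarrow> nat \<Rightarrow> nat \<Rightarrow> bool) \<Rightarrow> (nat \<times> nat \<times> nat \<times> nat) set" where
  "quads n P = {(a, b, x, y). 0 < a \<and> 0 < b \<and> 0 < x \<and> 0 < y \<and> a * x + b * y = n \<and> P a b x y}"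

abbreviation "all_quads n \<equiv> quads n (\<lambda>a b x y. True)"

lemma finite_quads [simp]: "finite (quads n P)"
proof (rule finite_subset)
  show "quads n P \<subseteq> {..n} \<times> {..n} \<times> {..n} \<times> {..n}"
  proof
    fix z assume "z \<in> quads n P"
    then obtain a b x y where z: "z = (a, b, x, y)"
      and pos: "0 < a" "0 < b" "0 < x" "0 < y" and n: "a * x + b * y = n"
      by (auto simp: quads_def)
    have "a \<le> a * x" "x \<le> a * x" "b \<le> b * y" "y \<le> b * y" using pos by simp_all
    then have "a \<le> n" "b \<le> n" "x \<le> n" "y \<le> n" using n by linarith+
    then show "z \<in> {..n} \<times> {..n} \<times> {..n} \<times> {..n}" using z by simp
  qed
qed simp

lemma sum_quads_split_ab:
  fixes f :: "nat \<times> nat \<times> nat \<times> nat \<Rightarrow> 'a :: comm_monoid_add"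
  shows "sum f (all_quads n) = sum f (quads n (\<lambda>a b x y. a < b))
     + sum f (quads n (\<lambda>a b x y. b < a)) + sum f (quads n (\<lambda>a b x y. a = b))"
proof -
  let ?A = "quads n (\<lambda>a b x y. a < b)" let ?B = "quads n (\<lambda>a b x y. b < a)"
  let ?C = "quads n (\<lambda>a b x y. a = b)"
  have "?A \<inter> ?B = {}" "(?A \<union> ?B) \<inter> ?C = {}" and "all_quads n = ?A \<union> ?B \<union> ?C"
    by (auto simp: quads_def)
  then show ?thesis by (simp add: sum.union_disjoint)
qed

lemma sum_quads_split_xy:
  fixes f :: "nat \<times> nat \<times> nat \<times> nat \<Rightarrow> 'a :: comm_monoid_add"
  shows "sum f (all_quads n) = sum f (quads n (\<lambda>a b x y. x < y))
     + sum f (quads n (\<lambda>a b x y. y < x)) + sum f (quads n (\<lambda>a b x y. x = y))"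
proof -
  let ?A = "quads n (\<lambda>a b x y. x < y)" let ?B = "quads n (\<lambda>a b x y. y < x)"
  let ?C = "quads n (\<lambda>a b x y. x = y)"
  have "?A \<inter> ?B = {}" "(?A \<union> ?B) \<inter> ?C = {}" and "all_quads n = ?A \<union> ?B \<union> ?C"
    by (auto simp: quads_def)
  then show ?thesis by (simp add: sum.union_disjoint)
qed

lemma sum_quads_swap:
  "(\<Sum>(a, b, x, y) \<in> quads n P. f a b x y) =
   (\<Sum>(a, b, x, y) \<in> quads n (\<lambda>a b x y. P b a y x). f b a y x)"
  by (intro sum.reindex_bij_witness[of _ "\<lambda>(a, b, x, y). (b, a, y, x)" "\<lambda>(a, b, x, y). (b, a, y, x)"])
     (auto simp: quads_def add.commute)

text \<open>The identity \<open>a x + b y = a (x + y) + (b - a) y\<close>: a Euclidean step on \<open>(a, b)\<close> is undone by a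
  Euclidean step on \<open>(x, y)\<close>, so it exchanges the region where \<open>a < b\<close> with the one where \<open>y < x\<close>.\<close>

lemma sum_quads_subtract:
  "(\<Sum>(a, b, x, y) \<in> quads n (\<lambda>a b x y. y < x). f a b) =
   (\<Sum>(a, b, x, y) \<in> quads n (\<lambda>a b x y. a < b). f a (b - a))"
proof (intro sum.reindex_bij_witness[of _ "\<lambda>(a, b, x, y). (a, b - a, x + y, y)"
      "\<lambda>(a, b, x, y). (a, a + b, x - y, y)"], goal_cases)
  case (4 z)
  then obtain a b x y where z: "z = (a, b, x, y)"
    and pos: "0 < a" "0 < x" "0 < y" "a < b" and n: "a * x + b * y = n"
    by (auto simp: quads_def)
  obtain c where c: "b = a + c" "0 < c"
    using less_imp_add_positive[OF pos(4)] by auto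
  have "a * (x + y) + c * y = n"
    using n by (simp add: c algebra_simps)
  then show ?case using pos c by (simp add: z quads_def)
next
  case (2 z)
  then obtain a b x y where z: "z = (a, b, x, y)"
    and pos: "0 < a" "0 < b" "0 < y" "y < x" and n: "a * x + b * y = n"
    by (auto simp: quads_def)
  obtain w where w: "x = y + w" "0 < w"
    using less_imp_add_positive[OF pos(4)] by auto
  have "a * w + (a + b) * y = n"
    using n by (simp add: w algebra_simps)
  then show ?case using pos w by (simp add: z quads_def)
qed (auto simp: quads_def)


text \<open>For \<open>x = y\<close> the equation reads \<open>(a + b) x = n\<close>, so that \<open>d = a + b\<close> runs through the divisors of
  \<open>n\<close> and \<open>a\<close> is free below \<open>d\<close>.\<close>

lemma sum_quads_diagonal_xy:
  fixes f :: "nat \<Rightarrow> nat \<Rightarrow> 'a :: comm_monoid_add"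
  assumes "0 < n"
  shows "(\<Sum>(a, b, x, y) \<in> quads n (\<lambda>a b x y. x = y). f a b) =
         (\<Sum>d | d dvd n. \<Sum>a\<in>{1..<d}. f a (d - a))"
proof -
  have "(\<Sum>(a, b, x, y) \<in> quads n (\<lambda>a b x y. x = y). f a b) =
        (\<Sum>(d, a) \<in> (SIGMA d:{d. d dvd n}. {1..<d}). f a (d - a))"
  proof (intro sum.reindex_bij_witness[of _ "\<lambda>(d, a). (a, d - a, n div d, n div d)"
        "\<lambda>(a, b, x, y). (a + b, a)"], goal_cases)
    case (1 z)
    then show ?case by (auto simp: quads_def simp flip: distrib_right)
  next
    case (2 z)
    then show ?case by (auto simp: quads_def simp flip: distrib_right)
  next
    case (4 z)
    then obtain d a where z: "z = (d, a)" "d dvd n" "1 \<le> a" "a < d" by auto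
    then have "a * (n div d) + (d - a) * (n div d) = n"
      by (simp flip: distrib_right)
    moreover have "0 < n div d" using z(2) assms by (auto elim: dvdE)
    ultimately show ?case using z by (auto simp: quads_def)
  qed (auto simp: quads_def)
  also have "\<dots> = (\<Sum>d | d dvd n. \<Sum>a\<in>{1..<d}. f a (d - a))"
    using assms by (subst sum.Sigma) (auto intro: finite_divisors_nat)
  finally show ?thesis .
qed

text \<open>Dually, for \<open>a = b\<close> the equation reads \<open>a (x + y) = n\<close>, and \<open>n/a\<close> splits as \<open>x + y\<close> in
  \<open>n/a - 1\<close> ways.\<close>

lemma sum_quads_diagonal_ab:
  fixes f :: "nat \<Rightarrow> int"
  assumes "0 < n"
  shows "(\<Sum>(a, b, x, y) \<in> quads n (\<lambda>a b x y. a = b). f a) =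
         (\<Sum>d | d dvd n. (int (n div d) - 1) * f d)"
proof -
  have "(\<Sum>(a, b, x, y) \<in> quads n (\<lambda>a b x y. a = b). f a) =
        (\<Sum>(d, x) \<in> (SIGMA d:{d. d dvd n}. {1..<n div d}). f d)"
  proof (intro sum.reindex_bij_witness[of _ "\<lambda>(d, x). (d, d, x, n div d - x)"
        "\<lambda>(a, b, x, y). (a, x)"], goal_cases)
    case (1 z)
    then show ?case by (auto simp: quads_def simp flip: distrib_left)
  next
    case (2 z)
    then show ?case by (auto simp: quads_def simp flip: distrib_left)
  next
    case (4 z)
    then obtain d x where z: "z = (d, x)" "d dvd n" "1 \<le> x" "x < n div d" by auto
    then have "d * x + d * (n div d - x) = n"
      by (simp flip: distrib_left)
    moreover have "0 < d" using z(2) assms by (auto elim: dvdE)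
    ultimately show ?case using z by (auto simp: quads_def)
  qed (auto simp: quads_def)
  also have "\<dots> = (\<Sum>d | d dvd n. \<Sum>x\<in>{1..<n div d}. f d)"
    using assms by (subst sum.Sigma) (auto intro: finite_divisors_nat)
  also have "\<dots> = (\<Sum>d | d dvd n. (int (n div d) - 1) * f d)"
  proof (rule sum.cong)
    fix d assume "d \<in> {d. d dvd n}"
    then have "0 < n div d" using assms by (auto elim: dvdE)
    then show "(\<Sum>x\<in>{1..<n div d}. f d) = (int (n div d) - 1) * f d"
      by (simp add: of_nat_diff Suc_le_eq)
  qed simp
  finally show ?thesis .
qed

lemma sum_squares_below:
  assumes "0 < d"
  shows "6 * (\<Sum>a\<in>{1..<d}. (int a)\<^sup>2) = (int d - 1) * int d * (2 * int d - 1)"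
  using assms
proof (induction d rule: nat_induct_non_zero)
  case (Suc d)
  then show ?case by (simp add: algebra_simps power2_eq_square)
qed simp

lemma convolution_W_1_quads:
  "convolution_W 1 1 n = (\<Sum>(a, b, x, y) \<in> all_quads n. a * b)"
proof -
  let ?I = "{(l, m). l + m = n}"
  let ?P = "\<lambda>l. {(d, e). 0 < d \<and> 0 < e \<and> d * e = (l::nat)}"
  have fin_I: "finite ?I"
    by (rule finite_subset[of _ "{..n} \<times> {..n}"]) auto
  have fin_P: "finite (?P l)" for l
    by (rule finite_subset[of _ "{..l} \<times> {..l}"]) auto
  have "convolution_W 1 1 n =
        (\<Sum>(l, m) \<in> ?I. \<Sum>((a, x), (b, y)) \<in> ?P l \<times> ?P m. a * b)"
    unfolding convolution_W_def divisor_sigma_1_factor_pairs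
    by (simp add: sum_product sum.cartesian_product case_prod_unfold)
  also have "\<dots> = (\<Sum>((l, m), ((a, x), (b, y))) \<in> (SIGMA (l, m):?I. ?P l \<times> ?P m). a * b)"
    using fin_I fin_P by (subst sum.Sigma[symmetric]) (auto simp: case_prod_unfold)
  also have "\<dots> = (\<Sum>(a, b, x, y) \<in> all_quads n. a * b)"
    by (intro sum.reindex_bij_witness[of _
          "\<lambda>(a, b, x, y). ((a * x, b * y), ((a, x), (b, y)))"
          "\<lambda>(_, ((a, x), (b, y))). (a, b, x, y)"])
       (auto simp: quads_def)
  finally show ?thesis .
qed

text \<open>In \<open>\<Sum> (a + b)\<^sup>2\<close> split by the order of \<open>x, y\<close>; the Euclidean step turns \<open>a + b\<close> into the larger
  of \<open>a, b\<close> (step \<open>plus\<close>). In \<open>\<Sum> (a - b)\<^sup>2\<close> split by the order of \<open>a, b\<close>; the inverse step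
  turns the difference into a single entry (step \<open>minus\<close>). The two results involve \<open>b\<^sup>2\<close>
  summed over \<open>a < b\<close> and over \<open>y < x\<close>. By symmetry these are the sums of \<open>a\<^sup>2\<close> over \<open>b < a\<close> and over
  \<open>x < y\<close>, and since \<open>a\<close> is fixed by the Euclidean step the complementary sums of \<open>a\<^sup>2\<close>
  over \<open>a < b\<close> and \<open>y < x\<close> agree; hence the two differ by diagonal terms only (step \<open>diff\<close>).\<close>

lemma convolution_W_1_1_closed_form:
  "12 * int (convolution_W 1 1 n) =
     5 * int (divisor_sigma 3 (real n)) + (1 - 6 * int n) * int (divisor_sigma 1 (real n))"
proof (cases "n = 0")
  case True
  have "all_quads 0 = {}" by (auto simp: quads_def)
  then show ?thesis using True by (simp add: convolution_W_1_quads del: One_nat_def)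
next
  case False
  then have n: "0 < n" by simp
  define S :: "(nat \<Rightarrow> nat \<Rightarrow> nat \<Rightarrow> nat \<Rightarrow> bool) \<Rightarrow> (nat \<Rightarrow> nat \<Rightarrow> int) \<Rightarrow> int"
    where "S = (\<lambda>P f. \<Sum>(a, b, x, y) \<in> quads n P. f a b)"
  let ?T = "\<lambda>a b x y. True"
  let ?ablt = "\<lambda>a b x y. a < b" let ?abgt = "\<lambda>a b x y. b < a" let ?abeq = "\<lambda>a b x y. a = b"
  let ?xylt = "\<lambda>a b x y. x < y" let ?xygt = "\<lambda>a b x y. y < x" let ?xyeq = "\<lambda>a b x y. x = y"
  have split_ab: "S ?T f = S ?ablt f + S ?abgt f + S ?abeq f" for f
    unfolding S_def by (rule sum_quads_split_ab)
  have split_xy: "S ?T f = S ?xylt f + S ?xygt f + S ?xyeq f" for f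
    unfolding S_def by (rule sum_quads_split_xy)
  have swap_ab: "S ?abgt f = S ?ablt (\<lambda>a b. f b a)" for f
    unfolding S_def by (rule sum_quads_swap)
  have swap_xy: "S ?xylt f = S ?xygt (\<lambda>a b. f b a)" for f
    unfolding S_def by (rule sum_quads_swap)
  have subtract: "S ?xygt f = S ?ablt (\<lambda>a b. f a (b - a))" for f
    unfolding S_def by (rule sum_quads_subtract)
  have S_cong: "S P f = S P g" if "\<And>a b x y. P a b x y \<Longrightarrow> f a b = g a b" for P f g
    unfolding S_def using that by (intro sum.cong) (auto simp: quads_def)

  have plus: "S ?T (\<lambda>a b. (int a + int b)\<^sup>2) =
      2 * S ?ablt (\<lambda>a b. (int b)\<^sup>2) + S ?xyeq (\<lambda>a b. (int a + int b)\<^sup>2)"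
  proof -
    have "S ?xylt (\<lambda>a b. (int a + int b)\<^sup>2) = S ?xygt (\<lambda>a b. (int a + int b)\<^sup>2)"
      by (simp add: swap_xy add.commute)
    moreover have "S ?xygt (\<lambda>a b. (int a + int b)\<^sup>2) = S ?ablt (\<lambda>a b. (int b)\<^sup>2)"
      unfolding subtract by (rule S_cong) (simp add: of_nat_diff)
    ultimately show ?thesis by (simp add: split_xy[of "\<lambda>a b. (int a + int b)\<^sup>2"])
  qed
  have minus: "S ?T (\<lambda>a b. (int a - int b)\<^sup>2) = 2 * S ?xygt (\<lambda>a b. (int b)\<^sup>2)"
  proof -
    have "S ?abgt (\<lambda>a b. (int a - int b)\<^sup>2) = S ?ablt (\<lambda>a b. (int a - int b)\<^sup>2)"
      by (simp add: swap_ab power2_commute)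
    moreover have "S ?abeq (\<lambda>a b. (int a - int b)\<^sup>2) = 0"
      unfolding S_def by (intro sum.neutral) (auto simp: quads_def)
    moreover have "S ?xygt (\<lambda>a b. (int b)\<^sup>2) = S ?ablt (\<lambda>a b. (int a - int b)\<^sup>2)"
      unfolding subtract by (rule S_cong) (simp add: of_nat_diff power2_commute)
    ultimately show ?thesis by (simp add: split_ab[of "\<lambda>a b. (int a - int b)\<^sup>2"])
  qed
  have diff: "S ?ablt (\<lambda>a b. (int b)\<^sup>2) - S ?xygt (\<lambda>a b. (int b)\<^sup>2) =
      S ?xyeq (\<lambda>a b. (int a)\<^sup>2) - S ?abeq (\<lambda>a b. (int a)\<^sup>2)"
  proof -
    have "S ?xygt (\<lambda>a b. (int a)\<^sup>2) = S ?ablt (\<lambda>a b. (int a)\<^sup>2)"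
      by (rule subtract)
    then show ?thesis
      using split_ab[of "\<lambda>a b. (int a)\<^sup>2"] split_xy[of "\<lambda>a b. (int a)\<^sup>2"]
        swap_ab[of "\<lambda>a b. (int a)\<^sup>2"] swap_xy[of "\<lambda>a b. (int a)\<^sup>2"] by simp
  qed
  have "4 * int (convolution_W 1 1 n) = 4 * S ?T (\<lambda>a b. int a * int b)"
    by (simp add: convolution_W_1_quads S_def case_prod_unfold del: One_nat_def)
  also have "\<dots> = S ?T (\<lambda>a b. (int a + int b)\<^sup>2) - S ?T (\<lambda>a b. (int a - int b)\<^sup>2)"
    unfolding S_def sum_subtractf[symmetric] sum_distrib_left
    by (intro sum.cong) (auto simp: power2_eq_square algebra_simps)
  also have "\<dots> = S ?xyeq (\<lambda>a b. (int a + int b)\<^sup>2) + 2 * S ?xyeq (\<lambda>a b. (int a)\<^sup>2)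
      - 2 * S ?abeq (\<lambda>a b. (int a)\<^sup>2)"
    using plus minus diff by simp
  finally have "12 * int (convolution_W 1 1 n) = 3 * S ?xyeq (\<lambda>a b. (int a + int b)\<^sup>2)
      + 6 * S ?xyeq (\<lambda>a b. (int a)\<^sup>2) - 6 * S ?abeq (\<lambda>a b. (int a)\<^sup>2)"
    by simp
  also have "\<dots> = (\<Sum>d | d dvd n. 3 * (\<Sum>a\<in>{1..<d}. (int a + int (d - a))\<^sup>2)
      + 6 * (\<Sum>a\<in>{1..<d}. (int a)\<^sup>2) - 6 * ((int (n div d) - 1) * (int d)\<^sup>2))"
    unfolding S_def sum_quads_diagonal_xy[OF n] sum_quads_diagonal_ab[OF n]
    by (simp only: sum.distrib sum_subtractf sum_distrib_left)
  also have "\<dots> = (\<Sum>d | d dvd n. 5 * int d ^ 3 + (1 - 6 * int n) * int d)"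
  proof (rule sum.cong)
    fix d assume "d \<in> {d. d dvd n}"
    then obtain e where e: "n = d * e" and d: "0 < d" using n by (auto elim: dvdE)
    have "(\<Sum>a\<in>{1..<d}. (int a + int (d - a))\<^sup>2) = (\<Sum>a\<in>{1..<d}. (int d)\<^sup>2)"
      by (intro sum.cong) (auto simp: of_nat_diff)
    also have "\<dots> = (int d - 1) * (int d)\<^sup>2"
      using d by (simp add: of_nat_diff Suc_le_eq)
    finally show "3 * (\<Sum>a\<in>{1..<d}. (int a + int (d - a))\<^sup>2)
        + 6 * (\<Sum>a\<in>{1..<d}. (int a)\<^sup>2) - 6 * ((int (n div d) - 1) * (int d)\<^sup>2)
      = 5 * int d ^ 3 + (1 - 6 * int n) * int d"
      using d by (simp only: sum_squares_below[OF d])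
        (simp add: e algebra_simps power2_eq_square power3_eq_cube)
  qed simp
  also have "\<dots> = 5 * int (divisor_sigma 3 (real n)) + (1 - 6 * int n) * int (divisor_sigma 1 (real n))"
    by (simp add: divisor_sigma_of_nat[OF n] sum.distrib sum_distrib_left)
  finally show ?thesis .
qed

section \<open>Generating functions\<close>

text \<open>\<open>\<alpha> l + \<alpha> m = n\<close> is solvable only for \<open>\<alpha>\<close> dividing \<open>n\<close>, and then means \<open>l + m = n/\<alpha>\<close>. The factor
  \<open>\<alpha>\<close> clears the denominator of \<open>6n/\<alpha>\<close> in the closed form at \<open>n/\<alpha>\<close>.\<close>

lemma convolution_W_equal_weights:
  assumes "0 < \<alpha>"
  shows "12 * of_nat \<alpha> * of_nat (convolution_W \<alpha> \<alpha> n) =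
     5 * of_nat \<alpha> * of_nat (divisor_sigma 3 (real n / real \<alpha>))
     + (of_nat \<alpha> - 6 * of_nat n) * (of_nat (divisor_sigma 1 (real n / real \<alpha>)) :: complex)"
proof (cases "\<alpha> dvd n")
  case True
  then obtain k where k: "n = \<alpha> * k" by (elim dvdE)
  have "{(l, m). \<alpha> * l + \<alpha> * m = n} = {(l, m). 1 * l + 1 * m = k}"
    using assms by (auto simp: k simp flip: distrib_left)
  then have W: "convolution_W \<alpha> \<alpha> n = convolution_W 1 1 k"
    by (simp only: convolution_W_def)
  have div: "real n / real \<alpha> = real k" using assms by (simp add: k)
  have "(of_int (12 * int (convolution_W 1 1 k)) :: complex) =
      of_int (5 * int (divisor_sigma 3 (real k)) + (1 - 6 * int k) * int (divisor_sigma 1 (real k)))"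
    by (simp only: convolution_W_1_1_closed_form)
  from arg_cong[OF this, of "\<lambda>z. of_nat \<alpha> * z"] show ?thesis
    unfolding W div by (simp add: k algebra_simps del: One_nat_def)
next
  case False
  have "{(l, m). \<alpha> * l + \<alpha> * m = n} = {}"
    using False by (auto simp flip: distrib_left)
  then have "convolution_W \<alpha> \<alpha> n = 0"
    by (simp only: convolution_W_def sum.empty)
  then show ?thesis using divisor_sigma_nonintegral[OF assms False] by simp
qed

text \<open>Comparison with the second derivative of the geometric series, whose coefficients
  \<open>(n + 1) (n + 2)\<close> dominate \<open>n\<^sup>2\<close>.\<close>

lemma summable_norm_divisor_sigma:
  fixes q :: complex
  assumes "norm q < 1"
  shows "summable (\<lambda>n. norm (of_nat (divisor_sigma 1 (real n)) * q ^ n))"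
proof (rule summable_comparison_test')
  have geom: "summable (\<lambda>n. 1 * x ^ n)" if "norm x < 1" for x :: real
    using summable_geometric[OF that] by simp
  have "summable (\<lambda>n. diffs (\<lambda>_. 1) n * x ^ n)" if "norm x < 1" for x :: real
    using termdiff_converges[OF that geom] by simp
  then have "summable (\<lambda>n. diffs (diffs (\<lambda>_. 1)) n * norm q ^ n)"
    using assms by (intro termdiff_converges[of _ 1]) auto
  then show "summable (\<lambda>n. diffs (diffs (\<lambda>_. 1 :: real)) n * norm q ^ n)" .
  fix n
  have "real (divisor_sigma 1 (real n)) \<le> real (n ^ 2)"
    by (simp only: of_nat_le_iff divisor_sigma_1_le_square)
  also have "\<dots> \<le> diffs (diffs (\<lambda>_. 1)) n"
    by (simp add: diffs_def power2_eq_square algebra_simps)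
  finally show "norm (norm (of_nat (divisor_sigma 1 (real n)) * q ^ n))
      \<le> diffs (diffs (\<lambda>_. 1 :: real)) n * norm q ^ n"
    by (simp add: norm_mult norm_power mult_right_mono)
qed

text \<open>This is \<open>\<Sum> \<sigma>(k) q\<^sup>\<alpha>\<^sup>k\<close>, written as a power series in \<open>q\<close> itself so that series for different
  \<open>\<alpha>\<close> can be multiplied coefficientwise.\<close>

definition sigma_series :: "nat \<Rightarrow> complex \<Rightarrow> complex" where
  "sigma_series \<alpha> q = (\<Sum>n. of_nat (divisor_sigma 1 (real n / real \<alpha>)) * q ^ n)"

text \<open>Both facts come from deleting the zero terms at the indices that \<open>\<alpha>\<close> does not divide.\<close>

lemma
  fixes q :: complex
  assumes "0 < \<alpha>" and "norm q < 1"
  shows summable_norm_sigma_series: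
      "summable (\<lambda>n. norm (of_nat (divisor_sigma 1 (real n / real \<alpha>)) * q ^ n))" (is "summable (\<lambda>n. norm (?f n))")
    and eisenstein_L_sigma_series: "eisenstein_L (q ^ \<alpha>) = 1 - 24 * sigma_series \<alpha> q"
proof -
  have mono: "strict_mono (\<lambda>k. \<alpha> * k)"
    using assms(1) by (simp add: strict_mono_def)
  have outside: "?f n = 0" if "n \<notin> range (\<lambda>k. \<alpha> * k)" for n
  proof -
    have "\<not> \<alpha> dvd n" using that by (auto elim: dvdE)
    from divisor_sigma_nonintegral[OF assms(1) this] show ?thesis by simp
  qed
  have inside: "?f (\<alpha> * k) = of_nat (divisor_sigma 1 (real k)) * (q ^ \<alpha>) ^ k" for k
    using assms(1) by (simp add: power_mult)
  have "norm (q ^ \<alpha>) < 1"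
    using assms by (simp add: norm_power power_less_one_iff)
  note summ = summable_norm_divisor_sigma[OF this]
  have reindex: "summable (\<lambda>k. norm (?f (\<alpha> * k))) \<longleftrightarrow> summable (\<lambda>n. norm (?f n))"
    by (rule summable_mono_reindex[OF mono, of "\<lambda>n. norm (?f n)"])
      (unfold norm_eq_zero, rule outside)
  have "summable (\<lambda>k. norm (?f (\<alpha> * k)))"
    unfolding inside by (rule summ)
  then show "summable (\<lambda>n. norm (?f n))"
    by (rule iffD1[OF reindex])
  have "sigma_series \<alpha> q = (\<Sum>k. ?f (\<alpha> * k))"
    unfolding sigma_series_def
    by (rule suminf_mono_reindex[OF mono, of ?f, symmetric]) (rule outside)
  also have "\<dots> = (\<Sum>k. of_nat (divisor_sigma 1 (real (Suc k))) * (q ^ \<alpha>) ^ Suc k)"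
    unfolding inside suminf_split_head[OF summable_norm_cancel[OF summ]] of_nat_0 divisor_sigma_0
    by simp
  finally show "eisenstein_L (q ^ \<alpha>) = 1 - 24 * sigma_series \<alpha> q"
    by (simp add: eisenstein_L_def)
qed

lemma sigma_series_sums:
  fixes q :: complex
  assumes "0 < \<alpha>" and "norm q < 1"
  shows "(\<lambda>n. of_nat (divisor_sigma 1 (real n / real \<alpha>)) * q ^ n) sums sigma_series \<alpha> q"
  unfolding sigma_series_def
  by (rule summable_sums[OF summable_norm_cancel[OF summable_norm_sigma_series[OF assms]]])

text \<open>The Cauchy product has the coefficients \<open>\<Sum>\<^sub>i \<sigma>(i/\<alpha>) \<sigma>((n - i)/\<beta>)\<close>; only \<open>i = \<alpha> l\<close> with
  \<open>n - i = \<beta> m\<close> contribute, which is the index set of the convolution sum.\<close>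

lemma sigma_series_product_sums:
  fixes q :: complex
  assumes "0 < \<alpha>" and "0 < \<beta>" and "norm q < 1"
  shows "(\<lambda>n. of_nat (convolution_W \<alpha> \<beta> n) * q ^ n) sums (sigma_series \<alpha> q * sigma_series \<beta> q)"
proof -
  let ?s = "\<lambda>\<alpha> n. divisor_sigma 1 (real n / real \<alpha>)"
  have coeff: "convolution_W \<alpha> \<beta> n = (\<Sum>i\<le>n. ?s \<alpha> i * ?s \<beta> (n - i))" for n
  proof -
    let ?h = "\<lambda>(l, m). \<alpha> * l"
    let ?A = "{(l, m). \<alpha> * l + \<beta> * m = n}"
    have inj: "inj_on ?h ?A"
      using assms by (auto simp: inj_on_def)
    have "(\<Sum>i\<le>n. ?s \<alpha> i * ?s \<beta> (n - i)) = (\<Sum>i\<in>?h ` ?A. ?s \<alpha> i * ?s \<beta> (n - i))"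
    proof (rule sum.mono_neutral_right)
      show "\<forall>i\<in>{..n} - ?h ` ?A. ?s \<alpha> i * ?s \<beta> (n - i) = 0"
      proof
        fix i assume i: "i \<in> {..n} - ?h ` ?A"
        have "\<not> (\<alpha> dvd i \<and> \<beta> dvd (n - i))"
        proof
          assume "\<alpha> dvd i \<and> \<beta> dvd (n - i)"
          then obtain l m where lm: "i = \<alpha> * l" "n - i = \<beta> * m" by (auto elim!: dvdE)
          then have "(l, m) \<in> ?A" using i by auto
          then have "i \<in> ?h ` ?A" using lm(1) by force
          with i show False by simp
        qed
        then show "?s \<alpha> i * ?s \<beta> (n - i) = 0"
          using divisor_sigma_nonintegral assms by auto
      qed
    qed auto
    also have "\<dots> = (\<Sum>(l, m)\<in>?A. divisor_sigma 1 (real l) * divisor_sigma 1 (real m))"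
      unfolding sum.reindex[OF inj]
      using assms by (intro sum.cong) auto
    finally show ?thesis by (simp only: convolution_W_def)
  qed
  have "(\<lambda>n. \<Sum>i\<le>n. (of_nat (?s \<alpha> i) * q ^ i) * (of_nat (?s \<beta> (n - i)) * q ^ (n - i)))
      sums (sigma_series \<alpha> q * sigma_series \<beta> q)"
    unfolding sigma_series_def using assms
    by (intro Cauchy_product_sums summable_norm_sigma_series)
  moreover have "(\<Sum>i\<le>n. (of_nat (?s \<alpha> i) * q ^ i) * (of_nat (?s \<beta> (n - i)) * q ^ (n - i)))
      = of_nat (convolution_W \<alpha> \<beta> n) * q ^ n" for n
    unfolding coeff of_nat_sum sum_distrib_right
    by (intro sum.cong) (auto simp: power_add[symmetric] algebra_simps)
  ultimately show ?thesis by simp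
qed

theorem theorem2p4:
  fixes \<alpha> \<beta> :: nat and q :: complex
  assumes "0 < \<alpha>" and "0 < \<beta>" and "coprime \<alpha> \<beta>" and "\<alpha> < \<beta>" and "norm q < 1"
  shows "summable (\<lambda>n. square_coeff \<alpha> \<beta> (Suc n) * q ^ Suc n) \<and>
    (of_nat \<alpha> * eisenstein_L (q ^ \<alpha>) - of_nat \<beta> * eisenstein_L (q ^ \<beta>)) ^ 2 =
      (of_nat \<alpha> - of_nat \<beta>) ^ 2 + (\<Sum>n. square_coeff \<alpha> \<beta> (Suc n) * q ^ Suc n)"
proof -
  let ?s = "\<lambda>\<gamma> n. of_nat (divisor_sigma 1 (real n / real \<gamma>)) :: complex"
  let ?W = "\<lambda>\<gamma> \<delta> n. of_nat (convolution_W \<gamma> \<delta> n) :: complex"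
  let ?F = "\<lambda>\<gamma>. sigma_series \<gamma> q"
  let ?a = "of_nat \<alpha> :: complex" let ?b = "of_nat \<beta> :: complex"
  note F = sigma_series_sums[OF _ assms(5)] and FF = sigma_series_product_sums[OF _ _ assms(5)]
  \<comment> \<open>Eliminating \<open>\<sigma>\<^sub>3\<close> in favour of the convolution sums with equal weights gives exactly the
    coefficients of the expanded square.\<close>
  have coeff: "square_coeff \<alpha> \<beta> n =
      576 * ?a\<^sup>2 * ?W \<alpha> \<alpha> n + 576 * ?b\<^sup>2 * ?W \<beta> \<beta> n - 1152 * ?a * ?b * ?W \<alpha> \<beta> n
      + 48 * ?a * (?b - ?a) * ?s \<alpha> n + 48 * ?b * (?a - ?b) * ?s \<beta> n" for n
  proof -
    have "576 * ?a\<^sup>2 * ?W \<alpha> \<alpha> n = 48 * ?a * (12 * ?a * ?W \<alpha> \<alpha> n)"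
         "576 * ?b\<^sup>2 * ?W \<beta> \<beta> n = 48 * ?b * (12 * ?b * ?W \<beta> \<beta> n)"
      by (simp_all add: power2_eq_square)
    then show ?thesis
      unfolding square_coeff_def convolution_W_equal_weights[OF assms(1)] convolution_W_equal_weights[OF assms(2)]
      by (simp add: power2_eq_square algebra_simps)
  qed
  let ?R = "576 * ?a\<^sup>2 * (?F \<alpha> * ?F \<alpha>) + 576 * ?b\<^sup>2 * (?F \<beta> * ?F \<beta>) - 1152 * ?a * ?b * (?F \<alpha> * ?F \<beta>)
      + 48 * ?a * (?b - ?a) * ?F \<alpha> + 48 * ?b * (?a - ?b) * ?F \<beta>"
  have "(\<lambda>n. 576 * ?a\<^sup>2 * (?W \<alpha> \<alpha> n * q ^ n) + 576 * ?b\<^sup>2 * (?W \<beta> \<beta> n * q ^ n)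
      - 1152 * ?a * ?b * (?W \<alpha> \<beta> n * q ^ n)
      + 48 * ?a * (?b - ?a) * (?s \<alpha> n * q ^ n) + 48 * ?b * (?a - ?b) * (?s \<beta> n * q ^ n)) sums ?R"
    by (intro sums_add sums_diff sums_mult F FF assms)
  then have "(\<lambda>n. square_coeff \<alpha> \<beta> n * q ^ n) sums ?R"
    by (simp only: coeff ring_distribs mult.assoc)
  moreover have "square_coeff \<alpha> \<beta> 0 = 0"
  proof -
    have "{(l, m). \<alpha> * l + \<beta> * m = 0} = {(0, 0)}" using assms by auto
    then have "convolution_W \<alpha> \<beta> 0 = 0" by (simp only: convolution_W_def) simp
    then show ?thesis by (simp add: square_coeff_def)
  qed
  ultimately have sums: "(\<lambda>n. square_coeff \<alpha> \<beta> (Suc n) * q ^ Suc n) sums ?R"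
    by (subst sums_Suc_iff) simp
  have "(?a * eisenstein_L (q ^ \<alpha>) - ?b * eisenstein_L (q ^ \<beta>))\<^sup>2 = (?a - ?b)\<^sup>2 + ?R"
    unfolding eisenstein_L_sigma_series[OF assms(1,5)] eisenstein_L_sigma_series[OF assms(2,5)]
    by (simp add: power2_eq_square algebra_simps)
  then show ?thesis using sums by (simp add: sums_iff)
qed

end
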